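(* For every fixed integer $n\ge 3$, we have $$m(v,n)\le\left[\left(1+2^{(3-n)/2}\right)(n-1)2^{n-1}+o(1)\right]v\log v,$$ where $o(1)\to 0$ as $v\to\infty$.
   Context: All graphs are finite and simple. A graph $G$ is $n$-existentially closed ($n$-e.c.) if for all subsets $S\subseteq V(G)$ with $|S|=n$ and all partitions $S=A\sqcup B$ (with $A$ or $B$ possibly empty), there exists a vertex in $V(G)\setminus S$ adjacent to all vertices in $A$ and to no vertices in $B$. $m(v,n)$ denotes the minimum number of edges in an $n$-e.c. graph with $v$ vertices. Here $\log$ is the natural logarithm. *)

theory Defs
  imports Complex_Main "HOL-Library.Ramsey" "HOL-Library.Extended_Real"
begin

(* nsets V 2 is the set of two-element subsets of V *)
definition simple_graph :: "'a set \<Rightarrow> 'a set set \<Rightarrow> bool" where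
  "simple_graph V E \<longleftrightarrow> finite V \<and> E \<subseteq> nsets V 2"

definition existentially_closed :: "nat \<Rightarrow> 'a set \<Rightarrow> 'a set set \<Rightarrow> bool" where
  "existentially_closed n V E \<longleftrightarrow>
     (\<forall>S A B. S \<subseteq> V \<and> card S = n \<and> A \<union> B = S \<and> A \<inter> B = {} \<longrightarrow>
        (\<exists>x \<in> V - S. (\<forall>a \<in> A. {x, a} \<in> E) \<and> (\<forall>b \<in> B. {x, b} \<notin> E)))"

(* Every finite graph is isomorphic to one whose vertices are natural numbers, so it
   suffices to range over those.  The value is in enat so that it is \<infinity>, and not 0,
   when there is no n-e.c. graph on v vertices; otherwise the infimum is attained. *)
definition min_edges :: "nat \<Rightarrow> nat \<Rightarrow> enat" where
  "min_edges v n =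
     Inf {enat (card E) | (V :: nat set) E.
            simple_graph V E \<and> card V = v \<and> existentially_closed n V E}"

end

theory Submission
  imports Defs "HOL-Library.Disjoint_Sets" "HOL-Real_Asymp.Real_Asymp"
begin

text \<open>Join a core of about (n - 1) 2^n ln v vertices at random, with probability 1/2 per pair, to
  one another and to all other vertices, and add no further edges. A union bound over the
  O(v^(n-1) ln v) sets of n vertices that meet the core shows that all of them find their witnesses
  in the core, while only o(v) of the v^n sets outside the core are expected to fail; deleting one
  vertex of each failing set costs o(v) vertices and removes no witness. The witness property is
  invariant under complementation among the random pairs, so at most half of these pairs need to be
  edges. This gives (n - 1) 2^(n-1) v ln v (1 + o(1)) edges. Since the theorem allows an additional
  constant factor greater than 1, the error term can be taken to be 0.\<close>

section \<open>Independent traces on disjoint blocks\<close>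

text \<open>A uniformly random subset of \<open>P\<close> has independent uniform traces on the
  disjoint blocks \<open>Q x\<close>, and each trace is the forbidden one with probability 1 / 2^n.
  The resulting product is written as an exact count, so no probability space has to be set
  up.\<close>

lemma card_Pow_avoiding:
  assumes "finite X" "finite P" "disjoint_family_on Q X"
    and "\<And>x. x \<in> X \<Longrightarrow> Q x \<subseteq> P" "\<And>x. x \<in> X \<Longrightarrow> card (Q x) = n"
    and "\<And>x. x \<in> X \<Longrightarrow> T x \<subseteq> Q x"
  shows "real (card {E \<in> Pow P. \<forall>x\<in>X. E \<inter> Q x \<noteq> T x}) = 2 ^ card P * (1 - 1 / 2 ^ n) ^ card X"
  using assms
proof (induction X arbitrary: P rule: finite_induct)
  case empty
  moreover have "{E \<in> Pow P. \<forall>x\<in>{}. E \<inter> Q x \<noteq> T x} = Pow P" by blast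
  ultimately show ?case by (simp only: card_Pow) simp
next
  case (insert y X)
  let ?F = "\<lambda>P X. {E \<in> Pow P. \<forall>x\<in>X. E \<inter> Q x \<noteq> T x}"
  have y: "Q y \<subseteq> P" "card (Q y) = n" "T y \<subseteq> Q y" by (simp_all add: insert.prems)
  have fin: "finite (Q y)" "finite (P - Q y)"
    using y(1) \<open>finite P\<close> finite_subset by blast+
  have disj: "Q x \<inter> Q y = {}" if "x \<in> X" for x
    using insert.prems(2) insert.hyps(2) that unfolding disjoint_family_on_def by (metis insertCI)
  have QX: "Q x \<subseteq> P - Q y" "card (Q x) = n" "T x \<subseteq> Q x" if "x \<in> X" for x
  proof -
    show "Q x \<subseteq> P - Q y" using insert.prems(3)[of x] disj[OF that] that by blast
  qed (simp_all add: insert.prems that)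
  \<comment> \<open>Splitting a set into its part outside \<open>Q y\<close> and its trace on
    \<open>Q y\<close> separates the conditions: by disjointness those for \<open>X\<close> see only
    the first part, and the one for \<open>y\<close> excludes just the trace
    \<open>T y\<close>.\<close>
  have "bij_betw (\<lambda>(E, R). E \<union> R) (?F (P - Q y) X \<times> (Pow (Q y) - {T y})) (?F P (insert y X))"
  proof (rule bij_betw_byWitness[where f' = "\<lambda>E. (E - Q y, E \<inter> Q y)"])
    show "\<forall>p\<in>?F (P - Q y) X \<times> (Pow (Q y) - {T y}).
        (\<lambda>E. (E - Q y, E \<inter> Q y)) ((\<lambda>(E, R). E \<union> R) p) = p"
      by fastforce
    show "\<forall>E\<in>?F P (insert y X). (\<lambda>(E, R). E \<union> R) ((\<lambda>E. (E - Q y, E \<inter> Q y)) E) = E"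
      by auto
    show "(\<lambda>(E, R). E \<union> R) ` (?F (P - Q y) X \<times> (Pow (Q y) - {T y})) \<subseteq> ?F P (insert y X)"
    proof
      fix U assume "U \<in> (\<lambda>(E, R). E \<union> R) ` (?F (P - Q y) X \<times> (Pow (Q y) - {T y}))"
      then obtain E R where U: "U = E \<union> R" and
        ER: "E \<subseteq> P - Q y" "R \<subseteq> Q y" "R \<noteq> T y" "\<forall>x\<in>X. E \<inter> Q x \<noteq> T x"
        by auto
      have "(E \<union> R) \<inter> Q y = R" using ER by blast
      moreover have "(E \<union> R) \<inter> Q x = E \<inter> Q x" if "x \<in> X" for x
        using ER(2) disj[OF that] by blast
      ultimately show "U \<in> ?F P (insert y X)"
        unfolding U using ER y(1) by auto
    qed
    show "(\<lambda>E. (E - Q y, E \<inter> Q y)) ` ?F P (insert y X) \<subseteq> ?F (P - Q y) X \<times> (Pow (Q y) - {T y})"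
    proof -
      have "(E - Q y) \<inter> Q x = E \<inter> Q x" if "x \<in> X" for E x
        using disj[OF that] by blast
      then show ?thesis by auto
    qed
  qed
  from bij_betw_same_card[OF this] have "card (?F P (insert y X)) = card (?F (P - Q y) X) * card (Pow (Q y) - {T y})"
    by (simp only: card_cartesian_product)
  moreover have "real (card (?F (P - Q y) X)) = 2 ^ card (P - Q y) * (1 - 1 / 2 ^ n) ^ card X"
  proof (rule insert.IH)
    show "disjoint_family_on Q X"
      using insert.prems(2) by (rule disjoint_family_on_mono[rotated]) blast
  qed (use fin QX in auto)
  moreover have "real (card (Pow (Q y) - {T y})) = 2 ^ n * (1 - 1 / 2 ^ n)"
    using y fin by (simp add: card_Diff_singleton card_Pow of_nat_diff right_diff_distrib)
  moreover have "card P = card (P - Q y) + n"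
    using y card_Diff_subset[of "Q y" P] card_mono[of P "Q y"] fin \<open>finite P\<close> by simp
  ultimately show ?case
    using insert.hyps by (simp only: of_nat_mult power_add card_insert_disjoint[OF insert.hyps] power_Suc mult_ac)
qed

section \<open>Failure probability of a single set\<close>

text \<open>The extension condition for one set \<open>S\<close>, where \<open>A\<close> and
  \<open>S - A\<close> are the two blocks of the partition. Witnesses are confined to
  \<open>K\<close> so that vertices outside \<open>K\<close> can later be deleted without losing
  any.\<close>

definition realises :: "'a set \<Rightarrow> 'a set set \<Rightarrow> 'a set \<Rightarrow> bool" where
  "realises K E S \<longleftrightarrow> (\<forall>A\<subseteq>S. \<exists>x\<in>K - S. \<forall>s\<in>S. {x, s} \<in> E \<longleftrightarrow> s \<in> A)"

text \<open>These are the pairs decided at random: the subsets of \<open>core_pairs K V\<close> form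
  the sample space, and two vertices outside \<open>K\<close> are never joined.\<close>

definition core_pairs :: "'a set \<Rightarrow> 'a set \<Rightarrow> 'a set set" where
  "core_pairs K V = {{x, y} |x y. x \<in> K \<and> y \<in> V \<and> x \<noteq> y}"

lemma core_pairs_subset_image: "core_pairs K V \<subseteq> (\<lambda>(x, y). {x, y}) ` (K \<times> V)"
  by (auto simp: core_pairs_def)

lemma finite_core_pairs: "finite K \<Longrightarrow> finite V \<Longrightarrow> finite (core_pairs K V)"
  by (rule finite_subset[OF core_pairs_subset_image]) simp

lemma card_core_pairs_le:
  assumes "finite K" "finite V"
  shows "card (core_pairs K V) \<le> card K * card V"
  using surj_card_le[of "K \<times> V", OF _ core_pairs_subset_image] assms
  by (simp add: card_cartesian_product)

text \<open>Union bound over the 2^n patterns \<open>A\<close>. For a fixed pattern, each candidate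
  \<open>x\<close> in \<open>K - S\<close> succeeds or fails according to its own \<open>n\<close>
  pairs with \<open>S\<close>, so all fail with probability (1 - 1 / 2^n)^|K - S|.\<close>

lemma card_not_realises_le:
  assumes "finite V" "K \<subseteq> V" "S \<in> nsets V n"
  shows "real (card {E \<in> Pow (core_pairs K V). \<not> realises K E S})
    \<le> 2 ^ n * 2 ^ card (core_pairs K V) * (1 - 1 / 2 ^ n) ^ (card K - n)"
proof -
  let ?P = "core_pairs K V" and ?r = "1 - 1 / 2 ^ n :: real"
  let ?Q = "\<lambda>x. (\<lambda>s. {x, s}) ` S" and ?T = "\<lambda>A x. (\<lambda>s. {x, s}) ` A"
  let ?F = "\<lambda>A. {E \<in> Pow ?P. \<forall>x\<in>K - S. E \<inter> ?Q x \<noteq> ?T A x}"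
  have S: "S \<subseteq> V" "finite S" "card S = n" and K: "finite K"
    using assms finite_subset by (auto simp: nsets_def)
  have P: "finite ?P" by (rule finite_core_pairs[OF K assms(1)])
  have bound: "real (card (?F A)) \<le> 2 ^ card ?P * ?r ^ (card K - n)" if "A \<subseteq> S" for A
  proof -
    have "real (card (?F A)) = 2 ^ card ?P * ?r ^ card (K - S)"
    proof (rule card_Pow_avoiding)
      \<comment> \<open>A pair {x, s} with \<open>s\<close> in \<open>S\<close> and \<open>x\<close>
        outside \<open>S\<close> determines \<open>x\<close>, so different candidates use different
        pairs.\<close>
      show "disjoint_family_on ?Q (K - S)"
        by (auto simp: disjoint_family_on_def doubleton_eq_iff)
      show "card (?Q x) = n" for x
        using S by (simp add: card_image inj_on_def doubleton_eq_iff)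
      show "?Q x \<subseteq> ?P" if "x \<in> K - S" for x
        using that S by (auto simp: core_pairs_def)
    qed (use K P that in auto)
    \<comment> \<open>\<open>S\<close> takes at most \<open>n\<close> candidates out of
      \<open>K\<close>, and the base lies in [0, 1], so lowering the exponent weakens the bound. For
      \<open>card K < n\<close> the truncated exponent is 0.\<close>
    also have "\<dots> \<le> 2 ^ card ?P * ?r ^ (card K - n)"
    proof -
      have "card K - n \<le> card (K - S)"
        using diff_card_le_card_Diff[OF S(2), of K] S by simp
      then show ?thesis by (intro mult_left_mono power_decreasing) auto
    qed
    finally show ?thesis .
  qed
  have "{E \<in> Pow ?P. \<not> realises K E S} \<subseteq> (\<Union>A\<in>Pow S. ?F A)"
  proof
    fix E assume E: "E \<in> {E \<in> Pow ?P. \<not> realises K E S}"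
    then have "\<not> realises K E S" by simp
    then obtain A where A: "A \<subseteq> S" "\<not> (\<exists>x\<in>K - S. \<forall>s\<in>S. {x, s} \<in> E \<longleftrightarrow> s \<in> A)"
      unfolding realises_def by metis
    have "E \<inter> ?Q x \<noteq> ?T A x" if "x \<in> K - S" for x
    proof
      assume eq: "E \<inter> ?Q x = ?T A x"
      have "\<exists>s\<in>S. ({x, s} \<in> E) \<noteq> (s \<in> A)" using A(2) that by metis
      then obtain s where s: "s \<in> S" "({x, s} \<in> E) \<noteq> (s \<in> A)" by metis
      have "{x, s} \<in> E \<longleftrightarrow> {x, s} \<in> E \<inter> ?Q x" using s(1) by simp
      also have "\<dots> \<longleftrightarrow> s \<in> A" unfolding eq by (force simp: doubleton_eq_iff)
      finally show False using s(2) by simp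
    qed
    then have "E \<in> ?F A" using E by simp
    then show "E \<in> (\<Union>A\<in>Pow S. ?F A)" using A(1) by (intro UN_I[of A]) simp_all
  qed
  then have "card {E \<in> Pow ?P. \<not> realises K E S} \<le> card (\<Union>A\<in>Pow S. ?F A)"
    using S P by (intro card_mono) auto
  also have "\<dots> \<le> (\<Sum>A\<in>Pow S. card (?F A))"
    using S by (intro card_UN_le) auto
  finally have le: "card {E \<in> Pow ?P. \<not> realises K E S} \<le> (\<Sum>A\<in>Pow S. card (?F A))" .
  have "real (card {E \<in> Pow ?P. \<not> realises K E S}) \<le> (\<Sum>A\<in>Pow S. real (card (?F A)))"
    using of_nat_mono[OF le, where 'a = real] by (simp only: of_nat_sum)
  also have "\<dots> \<le> (\<Sum>A\<in>Pow S. 2 ^ card ?P * ?r ^ (card K - n))"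
    by (intro sum_mono bound) simp
  finally show ?thesis using S by (simp add: card_Pow)
qed

section \<open>Counting n-sets and averaging over graphs\<close>

lemma card_nsets_le: "finite V \<Longrightarrow> card (nsets V k) \<le> card V ^ k"
  by (cases "k \<le> card V") (simp_all add: card_nsets binomial_le_pow binomial_eq_0)

text \<open>Removing a point of \<open>S \<inter> K\<close> leaves an (n - 1)-set. With a small core
  this saves almost a factor \<open>card V\<close> over all n-sets, which is why these sets can all
  be made to succeed.\<close>

lemma card_nsets_meeting_le:
  assumes "finite V" "K \<subseteq> V" "n > 0"
  shows "card {S \<in> nsets V n. S \<inter> K \<noteq> {}} \<le> card K * card V ^ (n - 1)"
proof -
  have fin: "finite K" "finite (nsets V (n - 1))"
    using assms finite_subset finite_imp_finite_nsets by auto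
  have "{S \<in> nsets V n. S \<inter> K \<noteq> {}} \<subseteq> (\<lambda>(x, T). insert x T) ` (K \<times> nsets V (n - 1))"
  proof
    fix S assume "S \<in> {S \<in> nsets V n. S \<inter> K \<noteq> {}}"
    then obtain x where S: "S \<subseteq> V" "finite S" "card S = n" "x \<in> S" "x \<in> K"
      by (auto simp: nsets_def)
    then have "S - {x} \<in> nsets V (n - 1)" "S = insert x (S - {x})"
      by (auto simp: nsets_def)
    then show "S \<in> (\<lambda>(x, T). insert x T) ` (K \<times> nsets V (n - 1))"
      using S by (intro image_eqI[of _ _ "(x, S - {x})"]) auto
  qed
  then have "card {S \<in> nsets V n. S \<inter> K \<noteq> {}} \<le> card (K \<times> nsets V (n - 1))"
    using fin by (intro surj_card_le) auto
  also have "\<dots> \<le> card K * card V ^ (n - 1)"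
    using card_nsets_le[OF assms(1)] by (simp add: card_cartesian_product)
  finally show ?thesis .
qed

text \<open>A failing set that meets K is given weight d + 1 and any other failing set weight 1, so that
  a graph whose total weight is at most d has no failing set of the first kind.\<close>

lemma exists_core_graph:
  assumes "finite V" "K \<subseteq> V" "n > 0"
    and small: "2 ^ n * (real (card V) ^ n + real (d + 1) * real (card K) * real (card V) ^ (n - 1))
       * (1 - 1 / 2 ^ n) ^ (card K - n) < real (d + 1)"
  shows "\<exists>E \<subseteq> core_pairs K V.
     (\<forall>S \<in> nsets V n. S \<inter> K \<noteq> {} \<longrightarrow> realises K E S) \<and>
     card {S \<in> nsets V n. S \<inter> K = {} \<and> \<not> realises K E S} \<le> d"
proof -
  let ?P = "core_pairs K V" and ?q = "(1 - 1 / 2 ^ n) ^ (card K - n) :: real"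
  let ?M = "{S \<in> nsets V n. S \<inter> K \<noteq> {}}" and ?O = "{S \<in> nsets V n. S \<inter> K = {}}"
  let ?bM = "\<lambda>E. {S \<in> ?M. \<not> realises K E S}" and ?bO = "\<lambda>E. {S \<in> ?O. \<not> realises K E S}"
  let ?w = "\<lambda>E. card (?bO E) + (d + 1) * card (?bM E)"
  have finN: "finite (nsets V n)"
    using assms(1) by (rule finite_imp_finite_nsets)
  have P: "finite ?P"
    using finite_core_pairs[OF finite_subset[OF assms(2,1)] assms(1)] .
  \<comment> \<open>Double counting: summing the failing sets over all graphs equals summing the
    failing graphs over all sets.\<close>
  have count: "real (\<Sum>E\<in>Pow ?P. card {S \<in> F. \<not> realises K E S})
      \<le> real (card F) * (2 ^ n * 2 ^ card ?P * ?q)" if F: "F \<subseteq> nsets V n" for F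
  proof -
    have fin: "finite F" by (rule finite_subset[OF F finN])
    have "(\<Sum>E\<in>Pow ?P. card {S \<in> F. \<not> realises K E S})
        = (\<Sum>S\<in>F. card {E \<in> Pow ?P. \<not> realises K E S})"
      using P fin by (intro sum_multicount_gen) auto
    then have "real (\<Sum>E\<in>Pow ?P. card {S \<in> F. \<not> realises K E S})
        = (\<Sum>S\<in>F. real (card {E \<in> Pow ?P. \<not> realises K E S}))" by simp
    also have "\<dots> \<le> (\<Sum>S\<in>F. 2 ^ n * 2 ^ card ?P * ?q)"
      using F assms by (intro sum_mono card_not_realises_le) auto
    finally show ?thesis by simp
  qed
  have q0: "?q \<ge> 0" by simp
  have "card ?O \<le> card V ^ n"
    using card_mono[OF finN, of ?O] card_nsets_le[OF assms(1), of n] by auto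
  from of_nat_mono[OF this, where 'a = real]
  have O: "real (card ?O) \<le> real (card V) ^ n" by (simp only: of_nat_power)
  have M: "real (card ?M) \<le> real (card K) * real (card V) ^ (n - 1)"
    using of_nat_mono[OF card_nsets_meeting_le[OF assms(1-3)], where 'a = real]
    by (simp only: of_nat_power of_nat_mult)
  \<comment> \<open>First-moment argument: the left side of \<open>small\<close> bounds the average
    of \<open>?w\<close>, while weights of at least \<open>d + 1\<close> throughout would force the
    average up to \<open>d + 1\<close>.\<close>
  have "\<exists>E\<in>Pow ?P. ?w E \<le> d"
  proof (rule ccontr)
    assume neg: "\<not> ?thesis"
    have "d + 1 \<le> ?w E" if "E \<in> Pow ?P" for E
    proof -
      have "\<not> ?w E \<le> d" using neg that by blast
      then show ?thesis by linarith
    qed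
    then have "(\<Sum>E\<in>Pow ?P. d + 1) \<le> (\<Sum>E\<in>Pow ?P. ?w E)" by (rule sum_mono)
    from of_nat_mono[OF this, where 'a = real]
    have "2 ^ card ?P * real (d + 1) \<le> real (\<Sum>E\<in>Pow ?P. ?w E)"
      using P by (simp only: sum_constant card_Pow of_nat_mult of_nat_power of_nat_numeral of_nat_id)
    also have "\<dots> = real (\<Sum>E\<in>Pow ?P. card (?bO E)) + real (d + 1) * real (\<Sum>E\<in>Pow ?P. card (?bM E))"
      by (simp only: sum.distrib sum_distrib_left[symmetric] of_nat_add of_nat_mult)
    also have "\<dots> \<le> real (card ?O) * (2 ^ n * 2 ^ card ?P * ?q)
        + real (d + 1) * (real (card ?M) * (2 ^ n * 2 ^ card ?P * ?q))"
      by (intro add_mono mult_left_mono count) auto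
    also have "\<dots> \<le> real (card V) ^ n * (2 ^ n * 2 ^ card ?P * ?q)
        + real (d + 1) * ((real (card K) * real (card V) ^ (n - 1)) * (2 ^ n * 2 ^ card ?P * ?q))"
      using O M q0 by (intro add_mono mult_left_mono mult_right_mono) auto
    also have "\<dots> = 2 ^ card ?P * (2 ^ n * (real (card V) ^ n
        + real (d + 1) * real (card K) * real (card V) ^ (n - 1)) * ?q)"
      by (simp add: algebra_simps)
    also have "\<dots> < 2 ^ card ?P * real (d + 1)"
      using small by (intro mult_strict_left_mono) auto
    finally show False by simp
  qed
  then obtain E where E: "E \<subseteq> ?P" "?w E \<le> d" by blast
  then have "card (?bM E) = 0" by (cases "card (?bM E)") auto
  then have "?bM E = {}" using finN by simp
  then have "\<forall>S \<in> nsets V n. S \<inter> K \<noteq> {} \<longrightarrow> realises K E S" by blast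
  moreover have "?bO E = {S \<in> nsets V n. S \<inter> K = {} \<and> \<not> realises K E S}" by blast
  ultimately show ?thesis using E by (intro exI[of _ E]) auto
qed

section \<open>Halving the edges by complementation\<close>

text \<open>Complementation exchanges the patterns \<open>A\<close> and \<open>S - A\<close>, and
  all patterns are demanded. As \<open>S\<close> lies in \<open>V\<close>, every pair between
  \<open>K - S\<close> and \<open>S\<close> is a core pair and hence is flipped.\<close>

lemma realises_complement:
  assumes "S \<subseteq> V"
  shows "realises K (core_pairs K V - E) S \<longleftrightarrow> realises K E S"
proof -
  have pair: "{x, s} \<in> core_pairs K V" if "x \<in> K - S" "s \<in> S" for x s
    using that assms by (auto simp: core_pairs_def)
  show ?thesis
  proof
    assume l: "realises K (core_pairs K V - E) S"
    show "realises K E S"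
      unfolding realises_def
    proof (intro allI impI)
      fix A assume "A \<subseteq> S"
      obtain x where "x \<in> K - S" "\<forall>s\<in>S. {x, s} \<in> core_pairs K V - E \<longleftrightarrow> s \<in> S - A"
        using l unfolding realises_def by (meson Diff_subset)
      then show "\<exists>x\<in>K - S. \<forall>s\<in>S. {x, s} \<in> E \<longleftrightarrow> s \<in> A" using pair by blast
    qed
  next
    assume r: "realises K E S"
    show "realises K (core_pairs K V - E) S"
      unfolding realises_def
    proof (intro allI impI)
      fix A assume "A \<subseteq> S"
      obtain x where "x \<in> K - S" "\<forall>s\<in>S. {x, s} \<in> E \<longleftrightarrow> s \<in> S - A"
        using r unfolding realises_def by (meson Diff_subset)
      then show "\<exists>x\<in>K - S. \<forall>s\<in>S. {x, s} \<in> core_pairs K V - E \<longleftrightarrow> s \<in> A" using pair by blast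
    qed
  qed
qed

text \<open>A graph and its complement within the core pairs have the same failing sets, and one of
  the two has at most half of the pairs. No concentration estimate for the number of edges is
  needed.\<close>

lemma exists_sparse_core_graph:
  assumes "finite V" "K \<subseteq> V" "n > 0"
    and "2 ^ n * (real (card V) ^ n + real (d + 1) * real (card K) * real (card V) ^ (n - 1))
       * (1 - 1 / 2 ^ n) ^ (card K - n) < real (d + 1)"
  shows "\<exists>E \<subseteq> core_pairs K V.
     (\<forall>S \<in> nsets V n. S \<inter> K \<noteq> {} \<longrightarrow> realises K E S) \<and>
     card {S \<in> nsets V n. S \<inter> K = {} \<and> \<not> realises K E S} \<le> d \<and>
     2 * card E \<le> card K * card V"
proof -
  let ?P = "core_pairs K V"
  obtain E where E: "E \<subseteq> ?P" "\<And>S. S \<in> nsets V n \<Longrightarrow> S \<inter> K \<noteq> {} \<Longrightarrow> realises K E S"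
    "card {S \<in> nsets V n. S \<inter> K = {} \<and> \<not> realises K E S} \<le> d"
    using exists_core_graph[OF assms] by blast
  have K: "finite K" using assms finite_subset by blast
  have P: "finite ?P" "card ?P \<le> card K * card V"
    using finite_core_pairs[OF K assms(1)] card_core_pairs_le[OF K assms(1)] .
  have compl: "realises K (?P - E) S \<longleftrightarrow> realises K E S" if "S \<in> nsets V n" for S
    using that by (intro realises_complement) (auto simp: nsets_def)
  show ?thesis
  proof (cases "2 * card E \<le> card K * card V")
    case True
    then show ?thesis using E by blast
  next
    case False
    have "card (?P - E) = card ?P - card E"
      using E P by (intro card_Diff_subset) (auto intro: finite_subset)
    then have "2 * card (?P - E) \<le> card K * card V" using False P by linarith
    moreover have "{S \<in> nsets V n. S \<inter> K = {} \<and> \<not> realises K (?P - E) S}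
        = {S \<in> nsets V n. S \<inter> K = {} \<and> \<not> realises K E S}"
      using compl by blast
    ultimately show ?thesis using E compl by (intro exI[of _ "?P - E"]) auto
  qed
qed

section \<open>Deleting failing sets and bounding \<open>min_edges\<close>\<close>

text \<open>One vertex of each failing set is deleted. All failing sets avoid \<open>K\<close>, so
  no witness is lost, and every n-set that survives was already realised.\<close>

lemma exists_existentially_closed_subgraph:
  assumes "finite V" "K \<subseteq> V" "n > 0" "d + card K \<le> card V" "E \<subseteq> core_pairs K V"
    and meet: "\<And>S. S \<in> nsets V n \<Longrightarrow> S \<inter> K \<noteq> {} \<Longrightarrow> realises K E S"
    and few: "card {S \<in> nsets V n. S \<inter> K = {} \<and> \<not> realises K E S} \<le> d"
  shows "\<exists>V' E'. simple_graph V' E' \<and> card V' = card V - d \<and> E' \<subseteq> E \<and> existentially_closed n V' E'"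
proof -
  define F where "F = {S \<in> nsets V n. S \<inter> K = {} \<and> \<not> realises K E S}"
  define c where "c = (\<lambda>S::'a set. SOME s. s \<in> S)"
  have fin: "finite K" "finite F"
    using finite_subset[OF assms(2,1)] finite_imp_finite_nsets[OF assms(1), of n]
    by (simp_all add: F_def)
  have c: "c S \<in> S" if "S \<in> F" for S
  proof -
    have "S \<noteq> {}" using that assms by (auto simp: F_def nsets_def)
    then show ?thesis unfolding c_def by (simp add: some_in_eq)
  qed
  have "card (c ` F) \<le> d" using card_image_le[OF fin(2), of c] few by (simp add: F_def)
  moreover have "c ` F \<subseteq> V - K" using c by (auto simp: F_def nsets_def)
  moreover have "d \<le> card (V - K)" using assms fin by (simp add: card_Diff_subset)
  \<comment> \<open>The chosen vertices are padded to exactly \<open>d\<close> vertices outside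
    \<open>K\<close>, so that the order of the remaining graph is known exactly.\<close>
  ultimately obtain D where D: "c ` F \<subseteq> D" "D \<subseteq> V - K" "card D = d"
    using exists_subset_between[of "c ` F" d "V - K"] assms(1) by auto
  let ?V = "V - D" and ?E = "E \<inter> nsets (V - D) 2"
  have "existentially_closed n ?V ?E"
    unfolding existentially_closed_def
  proof (intro allI impI, elim conjE)
    fix S A B assume S: "S \<subseteq> ?V" "card S = n" and AB: "A \<union> B = S" "A \<inter> B = {}"
    have SV: "S \<in> nsets V n"
      using S assms(1) finite_subset[of S V] by (auto simp: nsets_def)
    have "S \<notin> F" using c[of S] D(1) S(1) by blast
    then have "realises K E S" using meet SV by (auto simp: F_def)
    moreover have "A \<subseteq> S" using AB by blast
    ultimately have "\<exists>x\<in>K - S. \<forall>s\<in>S. {x, s} \<in> E \<longleftrightarrow> s \<in> A"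
      unfolding realises_def by simp
    then obtain x where x: "x \<in> K - S" "\<forall>s\<in>S. {x, s} \<in> E \<longleftrightarrow> s \<in> A" by (rule bexE)
    have "x \<in> ?V" using x(1) D(2) assms(2) by blast
    have pair: "{x, a} \<in> nsets ?V 2" if "a \<in> S" for a
    proof -
      have "x \<noteq> a" using x that by blast
      then show ?thesis using that S \<open>x \<in> ?V\<close> by (auto simp: nsets_def)
    qed
    show "\<exists>x\<in>?V - S. (\<forall>a\<in>A. {x, a} \<in> ?E) \<and> (\<forall>b\<in>B. {x, b} \<notin> ?E)"
    proof (intro bexI[of _ x] conjI ballI)
      show "{x, a} \<in> ?E" if "a \<in> A" for a
        using x(2) pair[of a] that AB(1) by blast
      show "{x, b} \<notin> ?E" if "b \<in> B" for b
        using x(2) that AB by blast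
      show "x \<in> ?V - S" using \<open>x \<in> ?V\<close> x(1) by blast
    qed
  qed
  moreover have "simple_graph ?V ?E" using assms by (simp add: simple_graph_def)
  moreover have "card ?V = card V - d"
    using D assms(1) card_Diff_subset[of D V] finite_subset[of D V] by auto
  ultimately show ?thesis by blast
qed

text \<open>The construction starts with \<open>v + d\<close> vertices and a core of size
  \<open>h\<close>, so that exactly \<open>v\<close> vertices remain after the deletion;
  \<open>h \<le> v\<close> leaves room to delete \<open>d\<close> vertices outside the core.\<close>

lemma min_edges_le:
  assumes "n > 0" "h \<le> v"
    and small: "2 ^ n * (real (v + d) ^ n + real (d + 1) * real h * real (v + d) ^ (n - 1))
       * (1 - 1 / 2 ^ n) ^ (h - n) < real (d + 1)"
  shows "ereal_of_enat (min_edges v n) \<le> ereal (real h * real (v + d) / 2)"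
proof -
  let ?V = "{..<v + d}" and ?K = "{..<h}"
  have "\<exists>E \<subseteq> core_pairs ?K ?V.
     (\<forall>S \<in> nsets ?V n. S \<inter> ?K \<noteq> {} \<longrightarrow> realises ?K E S) \<and>
     card {S \<in> nsets ?V n. S \<inter> ?K = {} \<and> \<not> realises ?K E S} \<le> d \<and>
     2 * card E \<le> card ?K * card ?V"
    using assms by (intro exists_sparse_core_graph) auto
  then obtain E where E: "E \<subseteq> core_pairs ?K ?V"
    "\<And>S. S \<in> nsets ?V n \<Longrightarrow> S \<inter> ?K \<noteq> {} \<Longrightarrow> realises ?K E S"
    "card {S \<in> nsets ?V n. S \<inter> ?K = {} \<and> \<not> realises ?K E S} \<le> d" "2 * card E \<le> h * (v + d)"
    by auto
  have "\<exists>V' E'. simple_graph V' E' \<and> card V' = card ?V - d \<and> E' \<subseteq> E \<and> existentially_closed n V' E'"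
    by (rule exists_existentially_closed_subgraph[where K = ?K]) (use E assms in auto)
  then obtain V' E' where G: "simple_graph V' E'" "card V' = v" "E' \<subseteq> E" "existentially_closed n V' E'"
    by auto
  have "finite E" by (rule finite_subset[OF E(1)]) (simp add: finite_core_pairs)
  then have "card E' \<le> card E" using G(3) by (rule card_mono)
  then have "2 * card E' \<le> h * (v + d)" using E(4) by linarith
  then have "real (2 * card E') \<le> real (h * (v + d))" by (rule of_nat_mono)
  then have le: "real (card E') \<le> real h * real (v + d) / 2" by simp
  have "min_edges v n \<le> enat (card E')"
    unfolding min_edges_def using G by (intro Inf_lower) blast
  then have "ereal_of_enat (min_edges v n) \<le> ereal_of_enat (enat (card E'))"
    by (simp only: ereal_of_enat_le_iff)
  also have "\<dots> \<le> ereal (real h * real (v + d) / 2)" using le by simp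
  finally show ?thesis .
qed

section \<open>Choice of parameters and asymptotics\<close>

theorem theorem17:
  fixes n :: nat
  assumes "n \<ge> 3"
  shows "\<exists>\<epsilon> :: nat \<Rightarrow> real. \<epsilon> \<longlonglongrightarrow> 0 \<and>
    (\<forall>\<^sub>F v in sequentially.
       ereal_of_enat (min_edges v n) \<le>
         ereal (((1 + 2 powr ((3 - real n) / 2)) * (real n - 1) * 2 ^ (n - 1) + \<epsilon> v)
                * real v * ln (real v)))"
proof -
  define c where "c = (2::real) powr ((3 - real n) / 2)"
  \<comment> \<open>The factor 1 + \<delta> is spent twice, on the core size and on the initial
    number of vertices. A quarter of \<open>c\<close> is small enough for (1 + \<delta>)^2 < 1 + c,
    because \<open>c \<le> 1\<close>.\<close>
  define \<delta> where "\<delta> = c / 4"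
  define p where "p = real n - 1"
  \<comment> \<open>With L ln v candidates the failure probability of a pattern is at most v^(-(1 +
    \<delta>) p). \<open>H\<close> bounds the core size, its constant covering the ceiling and the
    \<open>n\<close> vertices that \<open>S\<close> may occupy.\<close>
  define L where "L = (1 + \<delta>) * p * 2 ^ n"
  define H where "H = (\<lambda>v. L * ln (real v) + real (n + 1))"
  have c: "0 < c" "c \<le> 1"
    using assms powr_mono[of "(3 - real n) / 2" 0 "2 :: real"] by (auto simp: c_def)
  then have \<delta>: "0 < \<delta>" "\<delta> \<le> 1" by (auto simp: \<delta>_def)
  have p: "p > 0" using assms by (simp add: p_def)
  have L: "L > 0" using \<delta> p by (simp add: L_def)
  \<comment> \<open>Strictness matters: the slack times ln v later absorbs the additive constant in
    \<open>H\<close>.\<close>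
  have gap: "L * (1 + \<delta>) < (1 + c) * p * 2 ^ n"
  proof -
    have "c * c \<le> c * 1" using c by (intro mult_left_mono) auto
    moreover have "(1 + \<delta>) * (1 + \<delta>) = 1 + c / 2 + c * c / 16"
      by (simp add: \<delta>_def algebra_simps)
    ultimately have "(1 + \<delta>) * (1 + \<delta>) < 1 + c" using c by linarith
    then have "(1 + \<delta>) * (1 + \<delta>) * (p * 2 ^ n) < (1 + c) * (p * 2 ^ n)"
      using p by (intro mult_strict_right_mono) auto
    then show ?thesis by (simp add: L_def mult_ac)
  qed
  have ev1: "\<forall>\<^sub>F v in sequentially. H v \<le> real v"
    unfolding H_def using L by real_asymp
  \<comment> \<open>The left side bounds the average weight divided by \<open>d + 1\<close>; any
    positive power of v beats the logarithm in \<open>H\<close>.\<close>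
  have ev2: "\<forall>\<^sub>F v in sequentially. 4 ^ n * (1 / \<delta> + H v) * real v powr - (\<delta> * p) < 1"
  proof -
    have e: "\<delta> * p > 0" using \<delta> p by simp
    have lim: "(\<lambda>v::nat. (L * ln (real v) + b) * real v powr - e) \<longlonglongrightarrow> 0" if "e > 0" for b e :: real
      using that L by real_asymp
    have "(\<lambda>v. 4 ^ n * ((L * ln (real v) + (1 / \<delta> + real (n + 1))) * real v powr - (\<delta> * p)))
        \<longlonglongrightarrow> 4 ^ n * 0"
      by (intro tendsto_mult_left lim e)
    then have "(\<lambda>v. 4 ^ n * (1 / \<delta> + H v) * real v powr - (\<delta> * p)) \<longlonglongrightarrow> 0"
      by (simp add: H_def algebra_simps)
    then show ?thesis by (rule order_tendstoD) simp
  qed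
  have ev3: "\<forall>\<^sub>F v in sequentially. H v * (1 + \<delta>) \<le> (1 + c) * p * 2 ^ n * ln (real v)"
  proof -
    define k where "k = (1 + c) * p * 2 ^ n - L * (1 + \<delta>)"
    define b where "b = real (n + 1) * (1 + \<delta>)"
    have "k > 0" using gap by (simp add: k_def)
    then have "\<forall>\<^sub>F v::nat in sequentially. b \<le> k * ln (real v)" by real_asymp
    then show ?thesis
      by eventually_elim (simp add: k_def b_def H_def algebra_simps)
  qed
  have "\<forall>\<^sub>F v in sequentially. ereal_of_enat (min_edges v n) \<le>
      ereal ((1 + c) * p * 2 ^ (n - 1) * real v * ln (real v))"
    using ev1 ev2 ev3 eventually_gt_at_top[of 0]
  proof eventually_elim
    case (elim v)
    define h where "h = nat \<lceil>L * ln (real v)\<rceil> + n"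
    \<comment> \<open>A linear allowance for deletions is affordable because of the second factor 1
      + \<delta>.\<close>
    define d where "d = nat \<lfloor>\<delta> * real v\<rfloor>"
    have v: "real v \<ge> 1" using elim by simp
    have "0 \<le> L * ln (real v)" using L v by simp
    then have hn: "L * ln (real v) \<le> real (h - n)" and h: "real h \<le> H v"
      unfolding h_def H_def by linarith+
    have "0 \<le> \<delta> * real v" using \<delta> by simp
    then have d: "real d \<le> \<delta> * real v" "\<delta> * real v \<le> real (d + 1)"
      unfolding d_def by linarith+
    have "\<delta> * real v \<le> 1 * real v" using \<delta> by (intro mult_right_mono) auto
    then have m: "real (v + d) \<le> 2 * real v" using d by simp
    \<comment> \<open>This rests on 1 - x \<le> exp (-x) with x = 1 / 2^n.\<close>
    have q: "(1 - 1 / 2 ^ n) ^ (h - n) \<le> real v powr - ((1 + \<delta>) * p)"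
    proof -
      have "(1 - 1 / 2 ^ n :: real) ^ (h - n) \<le> exp (- (1 / 2 ^ n)) ^ (h - n)"
        using exp_ge_add_one_self[of "- (1 / 2 ^ n)"] by (intro power_mono) auto
      also have "\<dots> = exp (- (real (h - n) / 2 ^ n))"
        by (simp flip: exp_of_nat_mult)
      also have "\<dots> \<le> exp (- (L * ln (real v) / 2 ^ n))"
        using hn by (simp add: divide_right_mono)
      also have "\<dots> = real v powr - ((1 + \<delta>) * p)"
        using v by (simp add: powr_def L_def)
      finally show ?thesis .
    qed
    have vpow: "real v ^ n = real v * real v ^ (n - 1)"
      using assms by (cases n) auto
    have powp: "real v ^ (n - 1) = real v powr p"
      using assms v powr_realpow[of "real v" "n - 1"] by (simp add: p_def of_nat_diff)
    have "2 ^ n * (real (v + d) ^ n + real (d + 1) * real h * real (v + d) ^ (n - 1))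
        \<le> 2 ^ n * ((2 * real v) ^ n + real (d + 1) * H v * (2 * real v) ^ (n - 1))"
      using m h by (intro mult_left_mono add_mono mult_mono power_mono) auto
    also have "\<dots> = 2 ^ n * (2 ^ n * real v + real (d + 1) * H v * 2 ^ (n - 1)) * real v ^ (n - 1)"
      by (simp add: power_mult_distrib vpow algebra_simps)
    \<comment> \<open>Replacing v by (d + 1) / \<delta> makes \<open>d + 1\<close> a common factor,
      to be compared with the right side of \<open>small\<close>.\<close>
    also have "\<dots> \<le> 2 ^ n * (2 ^ n * (real (d + 1) / \<delta>) + real (d + 1) * H v * 2 ^ n) * real v ^ (n - 1)"
    proof -
      have "real v \<le> real (d + 1) / \<delta>" using d \<delta> by (simp add: field_simps)
      moreover have "(2::real) ^ (n - 1) \<le> 2 ^ n" by (intro power_increasing) auto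
      moreover have "H v \<ge> 0" using h by linarith
      ultimately show ?thesis by (intro mult_left_mono mult_right_mono add_mono) auto
    qed
    also have "\<dots> = real (d + 1) * (4 ^ n * (1 / \<delta> + H v)) * real v powr p"
    proof -
      have "(4::real) ^ n = 2 ^ n * 2 ^ n" by (simp flip: power_mult_distrib)
      then show ?thesis by (simp flip: powp add: algebra_simps)
    qed
    finally have main: "2 ^ n * (real (v + d) ^ n + real (d + 1) * real h * real (v + d) ^ (n - 1))
        \<le> real (d + 1) * (4 ^ n * (1 / \<delta> + H v)) * real v powr p" .
    have "2 ^ n * (real (v + d) ^ n + real (d + 1) * real h * real (v + d) ^ (n - 1))
        * (1 - 1 / 2 ^ n) ^ (h - n)
        \<le> real (d + 1) * (4 ^ n * (1 / \<delta> + H v)) * real v powr p * real v powr - ((1 + \<delta>) * p)"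
      using h \<delta> by (intro mult_mono[OF main q] mult_nonneg_nonneg add_nonneg_nonneg) auto
    \<comment> \<open>The exponents p and -(1 + \<delta>) p add up to -\<delta> p.\<close>
    also have "\<dots> = real (d + 1) * (4 ^ n * (1 / \<delta> + H v) * real v powr - (\<delta> * p))"
      using v by (simp add: mult.assoc powr_add[symmetric] distrib_right)
    also have "\<dots> < real (d + 1) * 1"
      using elim(2) by (intro mult_strict_left_mono) auto
    finally have small: "2 ^ n * (real (v + d) ^ n + real (d + 1) * real h * real (v + d) ^ (n - 1))
        * (1 - 1 / 2 ^ n) ^ (h - n) < real (d + 1)" by simp
    have "h \<le> v" using h elim(1) by linarith
    then have "ereal_of_enat (min_edges v n) \<le> ereal (real h * real (v + d) / 2)"
      using assms small by (intro min_edges_le) auto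
    also have "real h * real (v + d) / 2 \<le> H v * ((1 + \<delta>) * real v) / 2"
      using h d by (intro divide_right_mono mult_mono) (auto simp: algebra_simps)
    also have "\<dots> = H v * (1 + \<delta>) * real v / 2" by simp
    also have "\<dots> \<le> (1 + c) * p * 2 ^ n * ln (real v) * real v / 2"
      using elim(3) by (intro divide_right_mono mult_right_mono) auto
    also have "\<dots> = (1 + c) * p * 2 ^ (n - 1) * real v * ln (real v)"
      using assms by (cases n) auto
    finally show ?case by simp
  qed
  then show ?thesis
    by (intro exI[of _ "\<lambda>_. 0"]) (simp add: c_def p_def)
qed

end
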